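(* The expected runtime of Randomized-Spherical-Shell-HyperbolicNN is $O(\mathcal{T}\cdot\ln N+\mathcal{T}_{\mathcal{D}}\cdot N)$, where $\mathcal{T}$ is the runtime of one invocation of the approximate nearest neighbor oracle $\tilde{\mathcal{O}}$, $\mathcal{T}_{\mathcal{D}}$ is the runtime of one invocation of the decision oracle $\widetilde{\mathcal{DO}}$, and $N$ is the total number of buckets.
   Context: $\mathbb{H}_r$ is the Poincaré ball (open unit ball of $\mathbb{R}^r$) with distance $d_H(x,y)=\operatorname{arccosh}\left(1+\frac{2\|x-y\|^2}{(1-\|x\|^2)(1-\|y\|^2)}\right)$. Dataset split with width $w>1$ into $N$ buckets: bucket $B[i]$ consists of data points $x$ with $w^{i-1}\le\frac1{1-\|x\|^2}\le w^i$. $\tilde{\mathcal{O}}(q,P)$ is a $(1+\epsilon)$-approximate Euclidean nearest neighbor oracle: it returns some $p\in P$ with $\|p-q\|\le(1+\epsilon)\|q-n\|$, $n$ the Euclidean nearest neighbor of $q$ in $P$. The decision oracle $\widetilde{\mathcal{DO}}(q,R,P)$: if the Euclidean nearest neighbor $n$ of $q$ in $P$ satisfies $\|q-n\|\le R$, it answers YES by returning a certificate $x'\in P$ with $\|x'-q\|\le(1+\epsilon)R$. Randomized-Spherical-Shell-HyperbolicNN: order the buckets by a uniformly random permutation; set $n_H\leftarrow$ NULL, $dist_H\leftarrow\infty$; for each bucket $b$ in order, set $R\leftarrow\sqrt{\frac{\frac{\cosh(dist_H)-1}{2}(1-\|q\|^2)}{w^b(1+\epsilon)^2}}$; if $dist_H=\infty$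 or $\widetilde{\mathcal{DO}}(q,R,B[b])$ answers YES, compute $n_F\leftarrow\tilde{\mathcal{O}}(q,B[b])$ and, if $d_H(q,n_F)<dist_H$, set $dist_H\leftarrow d_H(q,n_F)$, $n_H\leftarrow n_F$. Return $n_H$.
   Formalization: Assumes N ≥ 2, nonempty buckets, that the decision oracle answers NO when the nearest neighbor is farther than R, and that points on the outer boundary spheres of different buckets are never equidistant from q; the bound fails or is undefined otherwise. An oracle decision takes at least unit time. *)

theory Defs
  imports "HOL-Probability.Probability" "HOL-Combinatorics.Combinatorics"
begin

text \<open>The Poincare ball is \<open>ball 0 1 :: (real ^ 'n) set\<close>.\<close>

definition hyp_dist :: "real ^ 'n \<Rightarrow> real ^ 'n \<Rightarrow> real" where
  "hyp_dist x y = arcosh (1 + 2 * (norm (x - y))\<^sup>2 / ((1 - (norm x)\<^sup>2) * (1 - (norm y)\<^sup>2)))"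


text \<open>
  \<open>I\<close> is the set of (positive) indices of the buckets, so there are \<open>card I\<close> of them. A point with
  \<open>1 / (1 - (norm x)\<^sup>2) = w ^ i\<close> satisfies the bounds of both bucket \<open>i\<close> and bucket \<open>i + 1\<close>. It has to
  be in one of them and may be in both: the split into half-open shells and the split into
  overlapping closed shells are both instances. Only nonempty buckets are indexed, because
  a nearest neighbour query on an empty set has no answer.
\<close>

definition is_split ::
    "real \<Rightarrow> (real ^ 'n) set \<Rightarrow> nat set \<Rightarrow> (nat \<Rightarrow> (real ^ 'n) set) \<Rightarrow> bool" where
  "is_split w P I B \<longleftrightarrow>
     finite I \<and> (\<Union>i\<in>I. B i) = P \<and>
     (\<forall>i\<in>I. 1 \<le> i \<and> B i \<noteq> {} \<and>
        (\<forall>x\<in>B i. w ^ (i - 1) \<le> 1 / (1 - (norm x)\<^sup>2) \<and> 1 / (1 - (norm x)\<^sup>2) \<le> w ^ i))"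


text \<open>
  Absence of ties: two data points lying exactly on the outer bounding spheres of two different
  buckets containing them are not at the same hyperbolic distance from the query. This is
  vacuous if a point on a common boundary sphere is always put in the outer one of the two shells.
\<close>

definition no_boundary_ties ::
    "real \<Rightarrow> nat set \<Rightarrow> (nat \<Rightarrow> (real ^ 'n) set) \<Rightarrow> real ^ 'n \<Rightarrow> bool" where
  "no_boundary_ties w I B q \<longleftrightarrow>
     (\<forall>i\<in>I. \<forall>j\<in>I. \<forall>x\<in>B i. \<forall>y\<in>B j.
        i \<noteq> j \<longrightarrow> 1 / (1 - (norm x)\<^sup>2) = w ^ i \<longrightarrow> 1 / (1 - (norm y)\<^sup>2) = w ^ j \<longrightarrow>
        hyp_dist q x \<noteq> hyp_dist q y)"


definition is_nearest :: "real ^ 'n \<Rightarrow> (real ^ 'n) set \<Rightarrow> real ^ 'n \<Rightarrow> bool" where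
  "is_nearest q P n \<longleftrightarrow> n \<in> P \<and> (\<forall>p\<in>P. norm (q - n) \<le> norm (q - p))"

definition approx_nn_oracle ::
    "real \<Rightarrow> (real ^ 'n \<Rightarrow> (real ^ 'n) set \<Rightarrow> real ^ 'n) \<Rightarrow> bool" where
  "approx_nn_oracle \<epsilon> nn \<longleftrightarrow>
     (\<forall>q P n. finite P \<longrightarrow> is_nearest q P n \<longrightarrow>
        nn q P \<in> P \<and> norm (nn q P - q) \<le> (1 + \<epsilon>) * norm (q - n))"

text \<open>\<open>Some x'\<close> is the answer YES with certificate \<open>x'\<close>, and \<open>None\<close> is the answer NO.\<close>

definition decision_oracle ::
    "real \<Rightarrow> (real ^ 'n \<Rightarrow> real \<Rightarrow> (real ^ 'n) set \<Rightarrow> (real ^ 'n) option) \<Rightarrow> bool" where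
  "decision_oracle \<epsilon> dec \<longleftrightarrow>
     (\<forall>q R P n. finite P \<longrightarrow> is_nearest q P n \<longrightarrow>
        (if norm (q - n) \<le> R
         then \<exists>x'\<in>P. dec q R P = Some x' \<and> norm (x' - q) \<le> (1 + \<epsilon>) * R
         else dec q R P = None))"


definition query_radius :: "real \<Rightarrow> real \<Rightarrow> real ^ 'n \<Rightarrow> nat \<Rightarrow> real \<Rightarrow> real" where
  "query_radius w \<epsilon> q b d =
     sqrt (((cosh d - 1) / 2 * (1 - (norm q)\<^sup>2)) / (w ^ b * (1 + \<epsilon>)\<^sup>2))"

text \<open>
  A state consists of \<open>n_H\<close> (\<open>None\<close> is NULL), \<open>dist_H\<close> and the time spent so far. An invocation of
  \<open>nn\<close> takes time \<open>T\<close>, one of \<open>dec\<close> takes time \<open>T_D\<close>, and all other work in an iteration (drawing the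
  next bucket, computing the radius, evaluating and comparing distances, assignments) takes
  time \<open>\<kappa>\<close>, as does the initialisation. The disjunction in the test is evaluated from left to right,
  so \<open>dec\<close> is not invoked while \<open>dist_H\<close> is infinite.
\<close>

type_synonym 'n shell_state = "(real ^ 'n) option \<times> ereal \<times> real"

definition shell_step ::
    "real \<Rightarrow> real \<Rightarrow> real \<Rightarrow>
     (real ^ 'n \<Rightarrow> (real ^ 'n) set \<Rightarrow> real ^ 'n) \<Rightarrow>
     (real ^ 'n \<Rightarrow> real \<Rightarrow> (real ^ 'n) set \<Rightarrow> (real ^ 'n) option) \<Rightarrow>
     real \<Rightarrow> real \<Rightarrow> (nat \<Rightarrow> (real ^ 'n) set) \<Rightarrow> real ^ 'n \<Rightarrow>
     nat \<Rightarrow> 'n shell_state \<Rightarrow> 'n shell_state" where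
  "shell_step \<kappa> T T_D nn dec w \<epsilon> B q b = (\<lambda>(n_H, dist_H, t).
     let R = query_radius w \<epsilon> q b (real_of_ereal dist_H);
         (yes, t') = (if dist_H = \<infinity> then (True, t + \<kappa>)
                      else (dec q R (B b) \<noteq> None, t + \<kappa> + T_D))
     in if yes then
          let n_F = nn q (B b); d = ereal (hyp_dist q n_F)
          in if d < dist_H then (Some n_F, d, t' + T) else (n_H, dist_H, t' + T)
        else (n_H, dist_H, t'))"

definition randomized_shell_nn ::
    "real \<Rightarrow> real \<Rightarrow> real \<Rightarrow>
     (real ^ 'n \<Rightarrow> (real ^ 'n) set \<Rightarrow> real ^ 'n) \<Rightarrow>
     (real ^ 'n \<Rightarrow> real \<Rightarrow> (real ^ 'n) set \<Rightarrow> (real ^ 'n) option) \<Rightarrow>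
     real \<Rightarrow> real \<Rightarrow> nat set \<Rightarrow> (nat \<Rightarrow> (real ^ 'n) set) \<Rightarrow> real ^ 'n \<Rightarrow>
     'n shell_state pmf" where
  "randomized_shell_nn \<kappa> T T_D nn dec w \<epsilon> I B q =
     map_pmf (\<lambda>bs. fold (shell_step \<kappa> T T_D nn dec w \<epsilon> B q) bs (None, \<infinity>, \<kappa>))
       (pmf_of_set (permutations_of_set I))"

definition expected_runtime ::
    "real \<Rightarrow> real \<Rightarrow> real \<Rightarrow>
     (real ^ 'n \<Rightarrow> (real ^ 'n) set \<Rightarrow> real ^ 'n) \<Rightarrow>
     (real ^ 'n \<Rightarrow> real \<Rightarrow> (real ^ 'n) set \<Rightarrow> (real ^ 'n) option) \<Rightarrow>
     real \<Rightarrow> real \<Rightarrow> nat set \<Rightarrow> (nat \<Rightarrow> (real ^ 'n) set) \<Rightarrow> real ^ 'n \<Rightarrow> real" where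
  "expected_runtime \<kappa> T T_D nn dec w \<epsilon> I B q =
     measure_pmf.expectation (randomized_shell_nn \<kappa> T T_D nn dec w \<epsilon> I B q)
       (\<lambda>(n_H, dist_H, t). t)"

end

theory Submission
  imports Defs
begin

text \<open>
  Let \<open>a b\<close> be the distance of a hypothetical point on the outer sphere of shell \<open>b\<close> whose Euclidean
  distance from \<open>q\<close> is \<open>1 + \<epsilon>\<close> times that of bucket \<open>b\<close>. The decision oracle answers YES on \<open>b\<close> iff
  \<open>a b\<close> is at most the current distance, and the point found in bucket \<open>b\<close> has hyperbolic distance
  \<open>D b \<le> a b\<close> from \<open>q\<close>. Hence \<open>b\<close> is searched after a set of other buckets only if \<open>a b\<close> is minimal
  among them all and \<open>D j = a j\<close> for every earlier \<open>j\<close> with \<open>a j = a b\<close>. Unless \<open>a j = 0\<close>, such an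
  equality puts the point found on the outer sphere of its shell, which the
  absence of ties allows for only one bucket; if \<open>a j = 0\<close>, then \<open>q\<close> lies in all tied buckets, and
  no point is in more than two shells. So at most two buckets of a set can be searched when they
  come last. The last of \<open>k\<close> buckets in
  random order is therefore searched with probability at most \<open>2 / k\<close>, and these probabilities sum
  to twice a harmonic number.
\<close>

section \<open>Backwards analysis over random orders\<close>

text \<open>Reversal permutes \<open>permutations_of_set A\<close>, so the recursion on the head
  becomes one on the last element.\<close>

lemma sum_permutations_of_set_snoc:
  assumes "A \<noteq> {}" "finite A"
  shows "sum f (permutations_of_set A) =
           (\<Sum>x\<in>A. \<Sum>xs\<in>permutations_of_set (A - {x}). f (xs @ [x]))"
proof -
  have rev: "sum g (permutations_of_set S) = sum (\<lambda>xs. g (rev xs)) (permutations_of_set S)"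
    for S :: "'a set" and g :: "'a list \<Rightarrow> 'b"
    using sum.reindex[of rev "permutations_of_set S" g] by (simp add: o_def inj_on_def)
  have "sum f (permutations_of_set A) =
          sum (\<lambda>xs. f (rev xs)) (\<Union>x\<in>A. (#) x ` permutations_of_set (A - {x}))"
    by (subst rev, subst permutations_of_set_nonempty) (use assms in simp_all)
  also have "\<dots> = (\<Sum>x\<in>A. sum (\<lambda>xs. f (rev xs)) ((#) x ` permutations_of_set (A - {x})))"
    using assms by (intro sum.UNION_disjoint) auto
  also have "\<dots> = (\<Sum>x\<in>A. \<Sum>xs\<in>permutations_of_set (A - {x}). f (rev xs @ [x]))"
    by (simp add: sum.reindex inj_on_def o_def)
  also have "\<dots> = (\<Sum>x\<in>A. \<Sum>xs\<in>permutations_of_set (A - {x}). f (xs @ [x]))"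
    by (subst (2) rev) simp
  finally show ?thesis .
qed

text \<open>Whether the last element may be charged \<open>T\<close> depends only on the set
  \<open>J\<close> of elements so far, not on their order. Given \<open>J\<close>, that element is
  uniform and at most \<open>m\<close> choices are charged, so the mean charge is at most
  \<open>m * T / card J\<close>. The assumptions pass to subsets, which carries the
  induction.\<close>

lemma sum_permutations_of_set_le_harm:
  fixes cost :: "'a list \<Rightarrow> real" and K T :: real
  assumes "finite A"
  assumes step: "\<And>bs b. set bs \<subseteq> A \<Longrightarrow> b \<in> A \<Longrightarrow> b \<notin> set bs \<Longrightarrow>
                   cost (bs @ [b]) \<le> cost bs + K + T * of_bool (b \<in> C (insert b (set bs)))"
  assumes card_C: "\<And>J. J \<subseteq> A \<Longrightarrow> J \<noteq> {} \<Longrightarrow> card (C J \<inter> J) \<le> m"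
  assumes "0 \<le> T"
  shows "sum cost (permutations_of_set A)
           \<le> fact (card A) * (cost [] + card A * K + m * T * harm (card A))"
  using \<open>finite A\<close> step card_C
proof (induction "card A" arbitrary: A)
  case 0
  then show ?case by (simp add: harm_expand)
next
  case (Suc k)
  let ?H = "harm :: nat \<Rightarrow> real"
  let ?M = "cost [] + k * K + m * T * ?H k"
  have card_A: "card A = Suc k" and "finite A" "A \<noteq> {}" using Suc by auto
  have slice: "(\<Sum>xs\<in>permutations_of_set (A - {x}). cost (xs @ [x]))
                 \<le> fact k * (?M + K + T * of_bool (x \<in> C A))" if "x \<in> A" for x
  proof -
    have card_rest: "card (A - {x}) = k" using that card_A \<open>finite A\<close> by simp
    have "(\<Sum>xs\<in>permutations_of_set (A - {x}). cost (xs @ [x]))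
            \<le> (\<Sum>xs\<in>permutations_of_set (A - {x}). cost xs + (K + T * of_bool (x \<in> C A)))"
    proof (intro sum_mono)
      fix xs assume "xs \<in> permutations_of_set (A - {x})"
      \<comment> \<open>Hence \<open>insert x (set xs) = A\<close>, and the single set
        \<open>C A\<close> decides the charge for every order of the rest.\<close>
      then have "set xs = A - {x}" by (simp add: permutations_of_set_def)
      with Suc.prems(2)[of xs x] that
      show "cost (xs @ [x]) \<le> cost xs + (K + T * of_bool (x \<in> C A))"
        by (auto simp: insert_absorb)
    qed
    also have "\<dots> = sum cost (permutations_of_set (A - {x})) + fact k * (K + T * of_bool (x \<in> C A))"
      using \<open>finite A\<close> card_rest by (simp add: sum.distrib)
    also have "sum cost (permutations_of_set (A - {x})) \<le> fact k * ?M"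
    proof -
      have "cost (bs @ [b]) \<le> cost bs + K + T * of_bool (b \<in> C (insert b (set bs)))"
        if "set bs \<subseteq> A - {x}" "b \<in> A - {x}" "b \<notin> set bs" for bs b
        using Suc.prems(2) that by blast
      moreover have "card (C J \<inter> J) \<le> m" if "J \<subseteq> A - {x}" "J \<noteq> {}" for J
        using Suc.prems(3) that by blast
      ultimately show ?thesis
        using Suc.hyps(1)[of "A - {x}"] card_rest \<open>finite A\<close> by blast
    qed
    finally show ?thesis by (simp add: algebra_simps)
  qed
  have "(\<Sum>x\<in>A. of_bool (x \<in> C A)) = real (card (C A \<inter> A))"
    using \<open>finite A\<close> by (simp add: Int_commute Int_def)
  also have "\<dots> \<le> real m" using Suc.prems(3)[of A] \<open>A \<noteq> {}\<close> by simp
  finally have count: "(\<Sum>x\<in>A. of_bool (x \<in> C A)) \<le> real m" .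
  have "sum cost (permutations_of_set A) \<le> (\<Sum>x\<in>A. fact k * (?M + K + T * of_bool (x \<in> C A)))"
    using slice by (subst sum_permutations_of_set_snoc) (use \<open>A \<noteq> {}\<close> \<open>finite A\<close> in \<open>auto intro: sum_mono\<close>)
  also have "\<dots> = fact k * (Suc k * (?M + K) + T * (\<Sum>x\<in>A. of_bool (x \<in> C A)))"
    by (simp add: sum.distrib card_A flip: sum_distrib_left del: sum_of_bool_eq)
  also have "\<dots> \<le> fact k * (Suc k * (?M + K) + T * m)"
    using count \<open>0 \<le> T\<close> by (intro mult_left_mono add_left_mono) auto
  \<comment> \<open>Relative to \<open>fact (Suc k)\<close>, the summand
    \<open>fact k * (T * m)\<close> is the new harmonic term \<open>m * T / Suc k\<close>.\<close>
  also have "\<dots> = fact (Suc k) * (cost [] + Suc k * K + m * T * ?H (Suc k))"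
    by (simp add: harm_Suc field_simps)
  finally show ?case by (simp add: card_A)
qed

section \<open>Thresholds and found points of single buckets\<close>

locale shell_search =
  fixes \<kappa> T T_D w \<epsilon> :: real
    and nn :: "real ^ 'n \<Rightarrow> (real ^ 'n) set \<Rightarrow> real ^ 'n"
    and dec :: "real ^ 'n \<Rightarrow> real \<Rightarrow> (real ^ 'n) set \<Rightarrow> (real ^ 'n) option"
    and P :: "(real ^ 'n) set" and I :: "nat set" and B :: "nat \<Rightarrow> (real ^ 'n) set"
    and q :: "real ^ 'n" and near :: "nat \<Rightarrow> real ^ 'n"
  assumes w: "1 < w" and eps: "0 \<le> \<epsilon>" and T_nonneg: "0 \<le> T" and T_D_nonneg: "0 \<le> T_D"
    and nn: "approx_nn_oracle \<epsilon> nn" and dec: "decision_oracle \<epsilon> dec"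
    and finite_P: "finite P" and P_ball: "P \<subseteq> ball 0 1" and q_ball: "q \<in> ball 0 1"
    and split: "is_split w P I B" and no_ties: "no_boundary_ties w I B q"
    and near: "\<And>i. i \<in> I \<Longrightarrow> is_nearest q (B i) (near i)"
begin

definition found :: "nat \<Rightarrow> real ^ 'n" where
  "found i = nn q (B i)"

definition found_dist :: "nat \<Rightarrow> real" where
  "found_dist i = hyp_dist q (found i)"

text \<open>The solution \<open>d\<close> of
  \<open>query_radius w \<epsilon> q i d = norm (q - near i)\<close>. This is \<open>a i\<close> of
  the overview, and \<open>found_dist i\<close> is \<open>D i\<close>.\<close>

definition threshold :: "nat \<Rightarrow> real" where
  "threshold i = arcosh (1 + 2 * ((1 + \<epsilon>) * norm (q - near i))\<^sup>2 * w ^ i / (1 - (norm q)\<^sup>2))"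

text \<open>Necessary for \<open>b\<close> to be searched after \<open>J - {b}\<close>, yet
  independent of the order of \<open>J\<close>, as the set \<open>C J\<close> of the backwards
  analysis must be.\<close>

definition candidates :: "nat set \<Rightarrow> nat set" where
  "candidates J = {b. \<forall>j\<in>J - {b}. threshold b \<le> threshold j \<and>
                        (threshold b = threshold j \<longrightarrow> found_dist j = threshold j)}"

lemma finite_I: "finite I"
  using split by (simp add: is_split_def)

lemma bucket_subset: "i \<in> I \<Longrightarrow> B i \<subseteq> P"
  using split by (auto simp: is_split_def)

lemma finite_bucket: "i \<in> I \<Longrightarrow> finite (B i)"
  using bucket_subset finite_P finite_subset by blast

lemma shell:
  assumes "i \<in> I" "x \<in> B i"
  shows "1 \<le> i" "w ^ (i - 1) \<le> 1 / (1 - (norm x)\<^sup>2)" "1 / (1 - (norm x)\<^sup>2) \<le> w ^ i"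
  using split assms by (auto simp: is_split_def)

lemma ball_pos: "x \<in> ball 0 1 \<Longrightarrow> 0 < 1 - (norm (x :: real ^ 'n))\<^sup>2"
  by (simp add: abs_square_less_1)

lemma q_pos: "0 < 1 - (norm q)\<^sup>2"
  using q_ball by (rule ball_pos)

lemma bucket_pos: "i \<in> I \<Longrightarrow> x \<in> B i \<Longrightarrow> 0 < 1 - (norm x)\<^sup>2"
  using bucket_subset P_ball by (intro ball_pos) blast

lemma found:
  assumes "i \<in> I"
  shows "found i \<in> B i" "norm (q - found i) \<le> (1 + \<epsilon>) * norm (q - near i)"
  using nn near[OF assms] finite_bucket[OF assms]
  by (auto simp: approx_nn_oracle_def found_def norm_minus_commute)

lemma threshold_arg_ge_1: "1 \<le> 1 + 2 * ((1 + \<epsilon>) * norm (q - near i))\<^sup>2 * w ^ i / (1 - (norm q)\<^sup>2)"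
  using q_pos w by simp

lemma found_dist_alt:
  "found_dist i = arcosh (1 + 2 * (norm (q - found i))\<^sup>2 * (1 / (1 - (norm (found i))\<^sup>2)) / (1 - (norm q)\<^sup>2))"
  by (simp add: found_dist_def hyp_dist_def mult.commute)

lemma found_dist_arg_ge_1:
  assumes "i \<in> I"
  shows "1 \<le> 1 + 2 * (norm (q - found i))\<^sup>2 * (1 / (1 - (norm (found i))\<^sup>2)) / (1 - (norm q)\<^sup>2)"
  using q_pos bucket_pos[OF assms found(1)[OF assms]] by simp

lemma found_dist_nonneg: "i \<in> I \<Longrightarrow> 0 \<le> found_dist i"
  unfolding found_dist_alt by (intro arcosh_nonneg_real found_dist_arg_ge_1)

lemma threshold_nonneg: "0 \<le> threshold i"
  unfolding threshold_def by (intro arcosh_nonneg_real threshold_arg_ge_1)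

lemma cosh_threshold:
  "cosh (threshold i) = 1 + 2 * ((1 + \<epsilon>) * norm (q - near i))\<^sup>2 * w ^ i / (1 - (norm q)\<^sup>2)"
  unfolding threshold_def by (intro cosh_arcosh_real threshold_arg_ge_1)

lemma cosh_found_dist:
  "i \<in> I \<Longrightarrow> cosh (found_dist i) =
     1 + 2 * (norm (q - found i))\<^sup>2 * (1 / (1 - (norm (found i))\<^sup>2)) / (1 - (norm q)\<^sup>2)"
  unfolding found_dist_alt by (intro cosh_arcosh_real found_dist_arg_ge_1)

text \<open>The guarantee of \<open>nn\<close> bounds the distance factor and the outer sphere
  bounds the shell factor.\<close>

lemma found_dist_le_threshold:
  assumes "i \<in> I"
  shows "found_dist i \<le> threshold i"
proof -
  have "(norm (q - found i))\<^sup>2 * (1 / (1 - (norm (found i))\<^sup>2))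
          \<le> ((1 + \<epsilon>) * norm (q - near i))\<^sup>2 * w ^ i"
    using found[OF assms] bucket_pos[OF assms found(1)[OF assms]] shell[OF assms found(1)[OF assms]] eps
    by (intro mult_mono power_mono) auto
  then have "cosh (found_dist i) \<le> cosh (threshold i)"
    unfolding cosh_found_dist[OF assms] cosh_threshold
    using q_pos by (simp add: divide_right_mono mult.assoc del: times_divide_eq_right)
  then show ?thesis
    using found_dist_nonneg[OF assms] threshold_nonneg by (simp add: cosh_real_nonneg_le_iff)
qed

text \<open>An equivalence because the oracle answers NO whenever the nearest distance exceeds the
  radius. The \<open>(1 + \<epsilon>)\<^sup>2\<close> in the radius becomes the factor
  \<open>1 + \<epsilon>\<close> in \<open>threshold\<close>.\<close>

lemma decision_iff_threshold_le:
  assumes "i \<in> I" "0 \<le> d"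
  shows "dec q (query_radius w \<epsilon> q i d) (B i) \<noteq> None \<longleftrightarrow> threshold i \<le> d"
proof -
  let ?X = "((cosh d - 1) / 2 * (1 - (norm q)\<^sup>2)) / (w ^ i * (1 + \<epsilon>)\<^sup>2)"
  have "dec q (query_radius w \<epsilon> q i d) (B i) \<noteq> None \<longleftrightarrow> norm (q - near i) \<le> sqrt ?X"
    using dec finite_bucket[OF assms(1)] near[OF assms(1)]
    unfolding decision_oracle_def query_radius_def by (smt (verit) option.distinct(1))
  also have "\<dots> \<longleftrightarrow> sqrt ((norm (q - near i))\<^sup>2) \<le> sqrt ?X" by simp
  also have "\<dots> \<longleftrightarrow> (norm (q - near i))\<^sup>2 \<le> ?X" by (simp only: real_sqrt_le_iff)
  also have "\<dots> \<longleftrightarrow> (norm (q - near i))\<^sup>2 * (w ^ i * (1 + \<epsilon>)\<^sup>2) \<le> (cosh d - 1) / 2 * (1 - (norm q)\<^sup>2)"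
    using w eps by (intro pos_le_divide_eq) simp
  also have "\<dots> \<longleftrightarrow>
      1 + 2 * ((norm (q - near i))\<^sup>2 * (w ^ i * (1 + \<epsilon>)\<^sup>2)) / (1 - (norm q)\<^sup>2) \<le> cosh d"
    using q_pos by (simp add: field_simps)
  also have "\<dots> \<longleftrightarrow> cosh (threshold i) \<le> cosh d"
    by (simp add: cosh_threshold power_mult_distrib mult_ac)
  also have "\<dots> \<longleftrightarrow> threshold i \<le> d"
    using assms threshold_nonneg by (intro cosh_real_nonneg_le_iff)
  finally show ?thesis .
qed

section \<open>Buckets that can be searched last\<close>

text \<open>Equality leaves no slack in the shell factor, since the distance factor
  \<open>(1 + \<epsilon>) * norm (q - near i)\<close> is positive.\<close>

lemma found_on_outer_sphere:
  assumes "i \<in> I" "found_dist i = threshold i" "near i \<noteq> q"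
  shows "1 / (1 - (norm (found i))\<^sup>2) = w ^ i"
proof (rule ccontr)
  assume "\<not> ?thesis"
  then have less: "1 / (1 - (norm (found i))\<^sup>2) < w ^ i"
    using shell[OF assms(1) found(1)[OF assms(1)]] by simp
  have "0 < ((1 + \<epsilon>) * norm (q - near i))\<^sup>2"
    using eps assms(3) by simp
  have "(norm (q - found i))\<^sup>2 * (1 / (1 - (norm (found i))\<^sup>2))
          \<le> ((1 + \<epsilon>) * norm (q - near i))\<^sup>2 * (1 / (1 - (norm (found i))\<^sup>2))"
    using found[OF assms(1)] bucket_pos[OF assms(1) found(1)[OF assms(1)]]
    by (intro mult_right_mono power_mono) auto
  also have "\<dots> < ((1 + \<epsilon>) * norm (q - near i))\<^sup>2 * w ^ i"
    using less \<open>0 < ((1 + \<epsilon>) * _)\<^sup>2\<close> by (intro mult_strict_left_mono)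
  finally have "cosh (found_dist i) < cosh (threshold i)"
    unfolding cosh_found_dist[OF assms(1)] cosh_threshold
    using q_pos by (simp add: divide_strict_right_mono mult.assoc del: times_divide_eq_right)
  then show False using assms(2) by simp
qed

lemma threshold_eq_0_iff: "threshold i = 0 \<longleftrightarrow> near i = q"
  using arcosh_eq_0_iff_real[OF threshold_arg_ge_1[of i]] w eps q_pos
  by (auto simp: threshold_def)

lemma no_distant_candidates:
  assumes "i \<in> candidates J" "i \<in> J" "k \<in> candidates J" "k \<in> J" "J \<subseteq> I"
  shows "k \<le> i + 1"
proof (rule ccontr)
  assume "\<not> k \<le> i + 1"
  then have "i \<noteq> k" "i \<le> k - 1" "i < k - 1" by auto
  have mem: "i \<in> I" "k \<in> I" using assms by auto
  have ik: "threshold i \<le> threshold k"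
      "threshold i = threshold k \<Longrightarrow> found_dist k = threshold k"
    and ki: "threshold k \<le> threshold i"
      "threshold k = threshold i \<Longrightarrow> found_dist i = threshold i"
    using assms \<open>i \<noteq> k\<close> by (auto simp: candidates_def)
  \<comment> \<open>Each candidate is compared with the other, so the thresholds bound each other,
    and the tie makes both found distances exact.\<close>
  have eq: "threshold i = threshold k" and
    exact: "found_dist i = threshold i" "found_dist k = threshold k"
    using ik ki by auto
  show False
  proof (cases "near i = q")
    case True
    then have "near k = q" using eq threshold_eq_0_iff by metis
    then have "q \<in> B i" "q \<in> B k"
      using True near[OF mem(1)] near[OF mem(2)] by (auto simp: is_nearest_def)
    \<comment> \<open>Now \<open>q\<close> lies in both shells, although shell \<open>k\<close>
      starts beyond the end of shell \<open>i\<close>. Adjacent closed shells share a sphere, hence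
      the bound \<open>i + 1\<close>.\<close>
    then have "w ^ (k - 1) \<le> w ^ i"
      using shell(2)[OF mem(2)] shell(3)[OF mem(1)] by (meson order_trans)
    moreover have "w ^ i < w ^ (k - 1)"
      using w \<open>i < k - 1\<close> by (rule power_strict_increasing[rotated])
    ultimately show False by simp
  next
    case False
    then have "near k \<noteq> q" using eq threshold_eq_0_iff by metis
    then have "hyp_dist q (found i) \<noteq> hyp_dist q (found k)"
      using no_ties mem found(1) \<open>i \<noteq> k\<close> found_on_outer_sphere exact False
      unfolding no_boundary_ties_def by metis
    then show False using eq exact by (simp add: found_dist_def)
  qed
qed

lemma card_candidates_le_2:
  assumes "J \<subseteq> I"
  shows "card (candidates J \<inter> J) \<le> 2"
proof (cases "candidates J \<inter> J = {}")
  case False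
  let ?C = "candidates J \<inter> J"
  have fin: "finite ?C" using assms finite_I finite_subset by blast
  have "Min ?C \<in> ?C" using fin False by (rule Min_in)
  then have "?C \<subseteq> {Min ?C .. Min ?C + 1}"
    using fin no_distant_candidates[OF _ _ _ _ assms] by fastforce
  then have "card ?C \<le> card {Min ?C .. Min ?C + 1}" by (intro card_mono) simp_all
  then show ?thesis by simp
qed simp

section \<open>Distance and time along a run\<close>

abbreviation step :: "nat \<Rightarrow> 'n shell_state \<Rightarrow> 'n shell_state" where
  "step \<equiv> shell_step \<kappa> T T_D nn dec w \<epsilon> B q"

abbreviation run :: "nat list \<Rightarrow> 'n shell_state" where
  "run bs \<equiv> fold step bs (None, \<infinity>, \<kappa>)"

definition best_dist :: "nat list \<Rightarrow> ereal" where
  "best_dist bs = fst (snd (run bs))"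

definition runtime :: "nat list \<Rightarrow> real" where
  "runtime bs = snd (snd (run bs))"

text \<open>The comparison with \<open>threshold i\<close> also covers an infinite
  \<open>dist_H\<close>, so both disjuncts of the test become one condition.\<close>

lemma step_dist:
  assumes "i \<in> I" "0 \<le> fst (snd s)"
  shows "fst (snd (step i s)) =
           (if ereal (threshold i) \<le> fst (snd s) then min (fst (snd s)) (ereal (found_dist i))
            else fst (snd s))"
proof (cases s)
  case (fields n d t)
  then show ?thesis
    using assms decision_iff_threshold_le[OF assms(1)]
    by (cases d) (auto simp: shell_step_def Let_def min_def found_dist_def found_def)
qed

text \<open>\<open>T_D\<close> is charged in every iteration, even while \<open>dec\<close> is
  skipped.\<close>

lemma step_time:
  assumes "i \<in> I" "0 \<le> fst (snd s)"
  shows "snd (snd (step i s)) \<le>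
           snd (snd s) + (\<kappa> + T_D) + T * of_bool (ereal (threshold i) \<le> fst (snd s))"
proof (cases s)
  case (fields n d t)
  then show ?thesis
    using assms decision_iff_threshold_le[OF assms(1)] T_D_nonneg
    by (cases d) (auto simp: shell_step_def Let_def)
qed

text \<open>The alternatives are that \<open>j\<close> was searched or that it was rejected. Both
  persist because \<open>best_dist\<close> never increases.\<close>

lemma best_dist_invariant:
  assumes "set bs \<subseteq> I"
  shows "0 \<le> best_dist bs \<and>
    (\<forall>j\<in>set bs. best_dist bs \<le> ereal (found_dist j) \<or> best_dist bs < ereal (threshold j))"
  using assms
proof (induction bs rule: rev_induct)
  case Nil
  then show ?case by (simp add: best_dist_def)
next
  case (snoc b bs)
  then have b: "b \<in> I" and IH: "0 \<le> best_dist bs"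
    "\<forall>j\<in>set bs. best_dist bs \<le> ereal (found_dist j) \<or> best_dist bs < ereal (threshold j)"
    by auto
  have dist: "best_dist (bs @ [b]) = (if ereal (threshold b) \<le> best_dist bs
                 then min (best_dist bs) (ereal (found_dist b)) else best_dist bs)"
    using step_dist[OF b, of "run bs"] IH(1) by (simp add: best_dist_def)
  then have "best_dist (bs @ [b]) \<le> best_dist bs" by auto
  then have "\<forall>j\<in>set bs. best_dist (bs @ [b]) \<le> ereal (found_dist j) \<or>
               best_dist (bs @ [b]) < ereal (threshold j)"
    using IH(2) by (meson order_trans order_le_less_trans)
  with dist IH(1) found_dist_nonneg[OF b] show ?case by (auto simp: not_le)
qed

text \<open>If \<open>j\<close> was rejected, the invariant gives a strict inequality of thresholds.
  If it was searched, \<open>found_dist j\<close> lies between the two thresholds, so a tie forces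
  it to equal both.\<close>

lemma searched_imp_candidate:
  assumes "set bs \<subseteq> I" "b \<notin> set bs" "ereal (threshold b) \<le> best_dist bs"
  shows "b \<in> candidates (insert b (set bs))"
proof -
  have "threshold b \<le> threshold j \<and> (threshold b = threshold j \<longrightarrow> found_dist j = threshold j)"
    if "j \<in> set bs" for j
  proof -
    have "ereal (threshold b) \<le> ereal (found_dist j) \<or> ereal (threshold b) < ereal (threshold j)"
      using best_dist_invariant[OF assms(1)] that assms(3) by (meson order_trans order_le_less_trans)
    moreover have "found_dist j \<le> threshold j"
      using that assms(1) found_dist_le_threshold by blast
    ultimately show ?thesis by auto
  qed
  then show ?thesis by (auto simp: candidates_def)
qed

lemma runtime_snoc:
  assumes "set bs \<subseteq> I" "b \<in> I" "b \<notin> set bs"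
  shows "runtime (bs @ [b]) \<le>
           runtime bs + (\<kappa> + T_D) + T * of_bool (b \<in> candidates (insert b (set bs)))"
proof -
  have "runtime (bs @ [b]) \<le>
          runtime bs + (\<kappa> + T_D) + T * of_bool (ereal (threshold b) \<le> best_dist bs)"
    using step_time[OF assms(2), of "run bs"] best_dist_invariant[OF assms(1)]
    by (simp add: runtime_def best_dist_def)
  also have "T * of_bool (ereal (threshold b) \<le> best_dist bs)
               \<le> T * of_bool (b \<in> candidates (insert b (set bs)))"
    using searched_imp_candidate[OF assms(1,3)] T_nonneg by (intro mult_left_mono) auto
  finally show ?thesis by simp
qed

lemma expected_runtime_le_harm:
  "expected_runtime \<kappa> T T_D nn dec w \<epsilon> I B q
     \<le> \<kappa> + card I * (\<kappa> + T_D) + 2 * T * harm (card I)"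
proof -
  have "expected_runtime \<kappa> T T_D nn dec w \<epsilon> I B q
          = measure_pmf.expectation (pmf_of_set (permutations_of_set I)) runtime"
    by (simp add: expected_runtime_def randomized_shell_nn_def runtime_def[abs_def] case_prod_unfold)
  also have "\<dots> = sum runtime (permutations_of_set I) / fact (card I)"
    using finite_I by (subst integral_pmf_of_set) auto
  also have "\<dots> \<le> runtime [] + card I * (\<kappa> + T_D) + real 2 * T * harm (card I)"
    using sum_permutations_of_set_le_harm[of I runtime, OF finite_I runtime_snoc card_candidates_le_2 T_nonneg]
    by (simp add: pos_divide_le_eq mult.commute)
  finally show ?thesis by (simp add: runtime_def)
qed

end

section \<open>From the harmonic bound to the logarithm\<close>

theorem theorem5:
  fixes \<kappa> :: real
  assumes "0 \<le> \<kappa>"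
  shows "\<exists>C>0. \<forall>(w::real) (\<epsilon>::real) (T::real) (T_D::real) nn dec
           (P :: (real ^ 'n) set) (I :: nat set) B q.
         1 < w \<longrightarrow> 0 \<le> \<epsilon> \<longrightarrow> 0 \<le> T \<longrightarrow> 1 \<le> T_D \<longrightarrow>
         approx_nn_oracle \<epsilon> nn \<longrightarrow> decision_oracle \<epsilon> dec \<longrightarrow>
         finite P \<longrightarrow> P \<subseteq> ball 0 1 \<longrightarrow> q \<in> ball 0 1 \<longrightarrow>
         is_split w P I B \<longrightarrow> no_boundary_ties w I B q \<longrightarrow> 2 \<le> card I \<longrightarrow>
         expected_runtime \<kappa> T T_D nn dec w \<epsilon> I B q
           \<le> C * (T * ln (real (card I)) + T_D * real (card I))"
\<comment> \<open>\<open>6\<close> comes from \<open>2 * T * harm\<close> with \<open>harm\<close>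
  at most \<open>3 * ln\<close>, \<open>1\<close> from the \<open>T_D\<close> calls, and
  \<open>2 * \<kappa>\<close> absorbs the overhead by \<open>1 \<le> T_D\<close>.\<close>
proof (intro exI[of _ "2 * \<kappa> + 7"] conjI allI impI)
  show "0 < 2 * \<kappa> + 7" using assms by simp
  fix w \<epsilon> T T_D :: real and nn :: "real ^ 'n \<Rightarrow> (real ^ 'n) set \<Rightarrow> real ^ 'n"
    and dec :: "real ^ 'n \<Rightarrow> real \<Rightarrow> (real ^ 'n) set \<Rightarrow> (real ^ 'n) option"
    and P :: "(real ^ 'n) set" and I :: "nat set" and B q
  assume hyps: "1 < w" "0 \<le> \<epsilon>" "0 \<le> T" "1 \<le> T_D" "approx_nn_oracle \<epsilon> nn" "decision_oracle \<epsilon> dec"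
    "finite P" "P \<subseteq> ball 0 1" "q \<in> ball 0 1" "is_split w P I B" "no_boundary_ties w I B q"
    and N: "2 \<le> card I"
  have "\<exists>n. is_nearest q (B i) n" if "i \<in> I" for i
  proof -
    have "finite (B i)" "B i \<noteq> {}"
      using hyps that by (auto simp: is_split_def intro: finite_subset[of _ P])
    then have "is_nearest q (B i) (arg_min_on (\<lambda>p. norm (q - p)) (B i))"
      by (auto simp: is_nearest_def intro: arg_min_if_finite arg_min_least)
    then show ?thesis ..
  qed
  then obtain near where near: "\<And>i. i \<in> I \<Longrightarrow> is_nearest q (B i) (near i)" by metis
  interpret shell_search \<kappa> T T_D w \<epsilon> nn dec P I B q near
    using hyps near by unfold_locales auto
  let ?N = "real (card I)"
  have "ln 2 \<le> ln ?N" using N by simp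
  then have ln_N: "1 \<le> 2 * ln ?N" using ln2_ge_two_thirds by linarith
  have "harm (card I) \<le> ln ?N + 1"
    \<comment> \<open>\<open>harm n - ln n\<close> decreases from its value \<open>1\<close> at
      \<open>n = 1\<close>.\<close>
    using euler_mascheroni_sequence_decreasing[of 1 "card I"] N by (simp add: harm_expand)
  also have "\<dots> \<le> 3 * ln ?N" using ln_N by simp
  finally have "2 * T * harm (card I) \<le> 2 * T * (3 * ln ?N)"
    using hyps(3) by (intro mult_left_mono) auto
  moreover have "\<kappa> + ?N * \<kappa> \<le> 2 * \<kappa> * (T_D * ?N)"
  proof -
    have "1 * ?N \<le> T_D * ?N" using hyps(4) by (intro mult_right_mono) auto
    then have "1 + ?N \<le> 2 * (T_D * ?N)" using N by linarith
    then have "\<kappa> * (1 + ?N) \<le> \<kappa> * (2 * (T_D * ?N))" using assms by (intro mult_left_mono)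
    then show ?thesis by (simp add: algebra_simps)
  qed
  moreover have "0 \<le> \<kappa> * (T * ln ?N)" "0 \<le> T * ln ?N" "0 \<le> T_D * ?N"
    using assms hyps ln_N by auto
  ultimately show "expected_runtime \<kappa> T T_D nn dec w \<epsilon> I B q
           \<le> (2 * \<kappa> + 7) * (T * ln (real (card I)) + T_D * real (card I))"
    using expected_runtime_le_harm by (simp add: algebra_simps)
qed

end
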